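(* Let $W\subseteq\mathbb{K}^E$ be a realization of a matroid $\mathsf{M}$, and let $e\in E$. Then $$\psi_W=\begin{cases}\psi_{W\setminus e}=\psi_{W/e}&\text{if $e$ is a loop in }\mathsf{M},\\ \psi_{W|_e}\cdot\psi_{W/e}=\psi_{W|_e}\cdot\psi_{W\setminus e}&\text{if $e$ is a coloop in }\mathsf{M},\\ \psi_{W\setminus e}+\psi_{W|_e}\cdot\psi_{W/e}&\text{otherwise,}\end{cases}$$ where $\psi_{W|_e}=x_e$ if $e$ is not a loop in $\mathsf{M}$. In particular, $$\frac{\partial\psi_W}{\partial x_e}=\begin{cases}0&\text{if $e$ is a loop in }\mathsf{M},\\ \psi_{W/e}=\psi_{W\setminus e}&\text{if $e$ is a coloop in }\mathsf{M},\\ \psi_{W/e}&\text{otherwise,}\end{cases}$$ $$\psi_W|_{x_e=0}=\begin{cases}\psi_{W\setminus e}=\psi_{W/e}&\text{if $e$ is a loop in }\mathsf{M},\\ 0&\text{if $e$ is a coloop in }\mathsf{M},\\ \psi_{W\setminus e}&\text{otherwise.}\end{cases}$$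
   Context: $\mathbb{K}$ is a field and $E$ a finite set, regarded as the standard basis of $\mathbb{K}^E$, with coordinates $x_e=e^\vee$ and $\mathbb{K}[x]=\mathbb{K}[x_e\mid e\in E]$. A subspace $W\subseteq\mathbb{K}^E$ is a realization of the matroid $\mathsf{M}$ on $E$ if the independent sets of $\mathsf{M}$ are exactly the $S\subseteq E$ such that the family $(e^\vee|_W)_{e\in S}$ is linearly independent in $W^\vee$. Then $r:=\dim W=\operatorname{rk}\mathsf{M}$. If $w^1,\dots,w^r$ is a basis of $W$ and $w^i_e=e^\vee(w^i)$, the configuration polynomial of $W$ is $$\psi_W=\sum_{B}\det\big((w^i_e)_{1\le i\le r,\ e\in B}\big)^2\prod_{e\in B}x_e\in\mathbb{K}[x],$$ the sum running over all bases $B$ of $\mathsf{M}$; $\psi_W=1$ if $r=0$. It is well defined only up to multiplication by $c^2$ with $c\in\mathbb{K}^*$; whenever $\psi_W$'s occur in a formula, the formula is meant to hold for a suitable choice of these factors. For $F\subseteq E$, let $\pi_F:\mathbb{K}^E\to\mathbb{K}^F$ be the coordinate projection. Restriction: $W|_F:=\pi_F(W)\subseteq\mathbb{K}^F$. Deletion: $W\setminus F:=W|_{E\setminus F}$. Contraction: $W/F:=W\cap\mathbb{K}^{E\setminus F}\subseteq\mathbb{K}^{E\setminus F}$. These realize the restriction $\mathsf{M}|_F$, the deletion $\mathsf{M}\setminus F$ and the contraction $\mathsf{M}/F$. For a singleton $F=\{e\}$ write $W|_e$, $W\setminus e$, $W/e$. A loop is an element of no basis, a coloop an element of every basis. *)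

theory Defs
  imports
    "HOL-Library.Poly_Mapping"
    "HOL-Library.Function_Algebras"
    "Jordan_Normal_Form.Determinant"
begin

text \<open>Matroids, given by a finite ground set and its independent sets.\<close>

locale matroid =
  fixes E :: "'e set" and indep :: "'e set \<Rightarrow> bool"
  assumes finite_ground: "finite E"
    and indep_subset_ground: "indep S \<Longrightarrow> S \<subseteq> E"
    and indep_empty: "indep {}"
    and indep_subset: "indep T \<Longrightarrow> S \<subseteq> T \<Longrightarrow> indep S"
    and indep_augment:
      "indep S \<Longrightarrow> indep T \<Longrightarrow> card S < card T \<Longrightarrow> \<exists>x \<in> T - S. indep (insert x S)"

definition matroid_bases :: "('e set \<Rightarrow> bool) \<Rightarrow> 'e set set" where
  "matroid_bases indep = {B. indep B \<and> (\<forall>S. indep S \<and> B \<subseteq> S \<longrightarrow> S = B)}"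

definition loop :: "('e set \<Rightarrow> bool) \<Rightarrow> 'e \<Rightarrow> bool" where
  "loop indep e \<longleftrightarrow> (\<forall>B \<in> matroid_bases indep. e \<notin> B)"

definition coloop :: "('e set \<Rightarrow> bool) \<Rightarrow> 'e \<Rightarrow> bool" where
  "coloop indep e \<longleftrightarrow> (\<forall>B \<in> matroid_bases indep. e \<in> B)"

text \<open>The space \<open>K^E\<close> is the set of functions vanishing outside \<open>E\<close>, inside the vector
  space of all functions from the element type to the field. In this way \<open>K^F\<close> is a subspace
  of \<open>K^E\<close> whenever \<open>F \<subseteq> E\<close>.\<close>

definition fscale :: "'k::field \<Rightarrow> ('e \<Rightarrow> 'k) \<Rightarrow> 'e \<Rightarrow> 'k" where
  "fscale c v = (\<lambda>x. c * v x)"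

global_interpretation fun_space: vector_space "fscale :: 'k::field \<Rightarrow> ('e \<Rightarrow> 'k) \<Rightarrow> 'e \<Rightarrow> 'k"
  by unfold_locales (auto simp: fscale_def algebra_simps)

definition coord_space :: "'e set \<Rightarrow> ('e \<Rightarrow> 'k::field) set" where
  "coord_space E = {v. \<forall>x. x \<notin> E \<longrightarrow> v x = 0}"

definition coord_proj :: "'e set \<Rightarrow> ('e \<Rightarrow> 'k::field) \<Rightarrow> 'e \<Rightarrow> 'k" where
  "coord_proj F v = (\<lambda>x. if x \<in> F then v x else 0)"

text \<open>Linear independence of the family of the coordinate functions indexed by \<open>S\<close> in the
  dual of \<open>W\<close>: a linear combination that vanishes on all of \<open>W\<close> has zero coefficients.
  It is a statement about families, so two elements of \<open>S\<close> with the same restricted coordinate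
  function make \<open>S\<close> dependent.\<close>

definition realized_indep :: "'e set \<Rightarrow> ('e \<Rightarrow> 'k::field) set \<Rightarrow> 'e set \<Rightarrow> bool" where
  "realized_indep E W S \<longleftrightarrow> S \<subseteq> E \<and>
     (\<forall>a :: 'e \<Rightarrow> 'k. (\<forall>w \<in> W. (\<Sum>x\<in>S. a x * w x) = 0) \<longrightarrow> (\<forall>x \<in> S. a x = 0))"

definition realization :: "'e set \<Rightarrow> ('e set \<Rightarrow> bool) \<Rightarrow> ('e \<Rightarrow> 'k::field) set \<Rightarrow> bool" where
  "realization E indep W \<longleftrightarrow>
     W \<subseteq> coord_space E \<and> fun_space.subspace W \<and> (\<forall>S. indep S \<longleftrightarrow> realized_indep E W S)"

definition restriction :: "('e \<Rightarrow> 'k::field) set \<Rightarrow> 'e set \<Rightarrow> ('e \<Rightarrow> 'k) set" where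
  "restriction W F = coord_proj F ` W"

definition deletion :: "'e set \<Rightarrow> ('e \<Rightarrow> 'k::field) set \<Rightarrow> 'e set \<Rightarrow> ('e \<Rightarrow> 'k) set" where
  "deletion E W F = restriction W (E - F)"

definition contraction :: "'e set \<Rightarrow> ('e \<Rightarrow> 'k::field) set \<Rightarrow> 'e set \<Rightarrow> ('e \<Rightarrow> 'k) set" where
  "contraction E W F = W \<inter> coord_space (E - F)"

definition basis_of :: "('e \<Rightarrow> 'k::field) set \<Rightarrow> ('e \<Rightarrow> 'k) list \<Rightarrow> bool" where
  "basis_of W ws \<longleftrightarrow>
     distinct ws \<and> fun_space.independent (set ws) \<and> fun_space.span (set ws) = W"

text \<open>Polynomials are finitely supported functions from monomials, i.e. finitely supported
  exponent vectors, to coefficients. All elements of the type \<open>'e\<close> are available as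
  variables; the polynomials below only involve those in the ground set.\<close>

type_synonym ('e, 'k) mpoly = "('e \<Rightarrow>\<^sub>0 nat) \<Rightarrow>\<^sub>0 'k"

definition const :: "'k::field \<Rightarrow> ('e, 'k) mpoly" where
  "const c = Poly_Mapping.single 0 c"

definition var :: "'e \<Rightarrow> ('e, 'k::field) mpoly" where
  "var x = Poly_Mapping.single (Poly_Mapping.single x 1) 1"

text \<open>If the exponent of \<open>x\<close> in the monomial \<open>m\<close> is zero, then the subtraction truncates, but
  the coefficient is zero.\<close>

definition partial_deriv :: "'e \<Rightarrow> ('e, 'k::field) mpoly \<Rightarrow> ('e, 'k) mpoly" where
  "partial_deriv x p = (\<Sum>m \<in> Poly_Mapping.keys p.
     Poly_Mapping.single (m - Poly_Mapping.single x 1)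
       (of_nat (Poly_Mapping.lookup m x) * Poly_Mapping.lookup p m))"

definition substitute :: "('e \<Rightarrow> ('e, 'k::field) mpoly) \<Rightarrow> ('e, 'k) mpoly \<Rightarrow> ('e, 'k) mpoly" where
  "substitute \<sigma> p = (\<Sum>m \<in> Poly_Mapping.keys p. const (Poly_Mapping.lookup p m) *
     (\<Prod>x \<in> Poly_Mapping.keys m. \<sigma> x ^ Poly_Mapping.lookup m x))"

definition set_var_zero :: "'e \<Rightarrow> ('e, 'k::field) mpoly \<Rightarrow> ('e, 'k) mpoly" where
  "set_var_zero x p = substitute (var(x := 0)) p"

text \<open>The columns of the minor are put in an arbitrary order; only the square of the determinant
  is used, and it does not depend on this order.\<close>

definition enumeration :: "'e set \<Rightarrow> 'e list" where
  "enumeration B = (SOME bs. distinct bs \<and> set bs = B)"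

definition basis_minor :: "('e \<Rightarrow> 'k::field) list \<Rightarrow> 'e set \<Rightarrow> 'k" where
  "basis_minor ws B =
     det (mat (length ws) (length ws) (\<lambda>(i, j). (ws ! i) (enumeration B ! j)))"

text \<open>The configuration polynomial of \<open>W\<close> with respect to its basis \<open>ws\<close>. The matroid on \<open>E\<close>
  realized by \<open>W\<close> is determined by \<open>W\<close>, and all its bases have \<open>length ws\<close> elements. If \<open>ws\<close> is
  empty, the only basis is \<open>{}\<close> and the polynomial is \<open>1\<close>.\<close>

definition config_poly ::
  "'e set \<Rightarrow> ('e \<Rightarrow> 'k::field) set \<Rightarrow> ('e \<Rightarrow> 'k) list \<Rightarrow> ('e, 'k) mpoly" where
  "config_poly E W ws = (\<Sum>B \<in> matroid_bases (realized_indep E W).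
     const ((basis_minor ws B)\<^sup>2) * (\<Prod>x\<in>B. var x))"

end

theory Submission
  imports Defs
begin

text \<open>
For a set \<open>B\<close> of size \<open>dim W\<close>, consider the square matrix of the values of the basis vectors of
\<open>W\<close> at the elements of \<open>B\<close>. A relation between its columns is a relation between the coordinate
functions on \<open>B\<close>, and a relation between its rows is a nonzero vector of \<open>W\<close> that vanishes on \<open>B\<close>;
either exists exactly if the minor is zero. Hence the bases are the sets of this size with nonzero
minor
(\<open>realized_basis_iff\<close>), the configuration polynomial is a sum over all subsets of size \<open>dim W\<close>
(\<open>config_poly_eq_sum_minors\<close>), and a change of the basis of \<open>W\<close> multiplies all minors by one
determinant. So the formulas need to be proved for one convenient choice of bases only, and the
squares of these determinants are the factors by which the polynomials are rescaled.

If \<open>e\<close> is a loop, then \<open>W\<close> lies in the hyperplane \<open>w e = 0\<close>, and \<open>W\<close>, its deletion and its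
contraction are the same space. If \<open>e\<close> is not a loop, choose \<open>w\<close> in \<open>W\<close> with \<open>w e = 1\<close> and extend
a basis of the hyperplane \<open>W/e\<close> by \<open>w\<close>. In a minor that uses the column \<open>e\<close>, this column has a
single nonzero entry, a \<open>1\<close> in the row of \<open>w\<close>; Laplace expansion turns these minors into those of
\<open>W/e\<close>, and they contribute \<open>x\<^sub>e \<psi>\<^sub>W\<^sub>/\<^sub>e\<close> (\<open>config_poly_split\<close>).

The minors avoiding \<open>e\<close> depend on whether the projection that forgets the coordinate \<open>e\<close> is
injective on \<open>W\<close>, that is, on whether \<open>W\<close> contains the \<open>e\<close>-th unit vector up to a scalar. It does
exactly if \<open>e\<close> is a coloop (\<open>coloop_iff_unit_vector\<close>). Then all minors avoiding \<open>e\<close> vanish, and the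
deletion coincides with the contraction. Otherwise the projection carries the basis of \<open>W\<close> to a
basis of the deletion with the same minors. In each case \<open>\<psi>\<^sub>W\<close> has the form \<open>p + x\<^sub>e q\<close> with \<open>p\<close> and
\<open>q\<close> free of \<open>x\<^sub>e\<close>, from which the derivative \<open>q\<close> and the value \<open>p\<close> at \<open>x\<^sub>e = 0\<close> are read off.
\<close>

section \<open>Homogeneous linear systems\<close>

lemma det_eq_0_iff_kernel:
  fixes f :: "nat \<Rightarrow> nat \<Rightarrow> 'k::field"
  shows "det (mat n n (\<lambda>(i, j). f i j)) = 0 \<longleftrightarrow>
    (\<exists>a. (\<exists>j<n. a j \<noteq> 0) \<and> (\<forall>i<n. (\<Sum>j<n. f i j * a j) = 0))"
proof -
  let ?A = "mat n n (\<lambda>(i, j). f i j)"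
  have row: "(?A *\<^sub>v v) $ i = (\<Sum>j<n. f i j * v $ j)" if "i < n" "v \<in> carrier_vec n" for i v
    using that by (auto simp: scalar_prod_def atLeast0LessThan intro!: sum.cong)
  show ?thesis
  proof
    assume "det ?A = 0"
    then obtain v where v: "v \<in> carrier_vec n" "v \<noteq> 0\<^sub>v n" "?A *\<^sub>v v = 0\<^sub>v n"
      using det_0_iff_vec_prod_zero_field[of ?A n] by auto
    have "\<exists>j<n. v $ j \<noteq> 0"
      using v(1,2) by (auto simp: vec_eq_iff)
    moreover have "\<forall>i<n. (\<Sum>j<n. f i j * v $ j) = 0"
      using row[OF _ v(1)] v(3) by (metis index_zero_vec(1))
    ultimately show "\<exists>a. (\<exists>j<n. a j \<noteq> 0) \<and> (\<forall>i<n. (\<Sum>j<n. f i j * a j) = 0)" by blast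
  next
    assume "\<exists>a. (\<exists>j<n. a j \<noteq> 0) \<and> (\<forall>i<n. (\<Sum>j<n. f i j * a j) = 0)"
    then obtain a j where a: "j < n" "a j \<noteq> 0" "\<forall>i<n. (\<Sum>j<n. f i j * a j) = 0" by blast
    have "vec n a \<noteq> 0\<^sub>v n" using a(1,2) by (metis index_vec index_zero_vec(1))
    moreover have "?A *\<^sub>v vec n a = 0\<^sub>v n"
      using a(3) row[of _ "vec n a"] by (intro eq_vecI) auto
    ultimately show "det ?A = 0"
      using det_0_iff_vec_prod_zero_field[of ?A n] by (metis mat_carrier vec_carrier)
  qed
qed

lemma det_eq_0_iff_left_kernel:
  fixes f :: "nat \<Rightarrow> nat \<Rightarrow> 'k::field"
  shows "det (mat n n (\<lambda>(i, j). f i j)) = 0 \<longleftrightarrow>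
    (\<exists>a. (\<exists>i<n. a i \<noteq> 0) \<and> (\<forall>j<n. (\<Sum>i<n. a i * f i j) = 0))"
proof -
  have "transpose_mat (mat n n (\<lambda>(i, j). f i j)) = mat n n (\<lambda>(i, j). f j i)" by auto
  then have "det (mat n n (\<lambda>(i, j). f i j)) = det (mat n n (\<lambda>(i, j). f j i))"
    by (metis det_transpose mat_carrier)
  then show ?thesis by (simp add: det_eq_0_iff_kernel mult.commute)
qed

text \<open>Zero rows make the system square. The matrix then has a left kernel vector, supported on one of
the added rows, so it is singular and has a right kernel vector as well.\<close>

lemma underdetermined_system_has_solution:
  fixes f :: "nat \<Rightarrow> nat \<Rightarrow> 'k::field"
  assumes "n < m"
  shows "\<exists>a. (\<exists>j<m. a j \<noteq> 0) \<and> (\<forall>i<n. (\<Sum>j<m. f i j * a j) = 0)"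
proof -
  define g where "g i j = (if i < n then f i j else 0)" for i j
  \<comment> \<open>Row \<open>n\<close> of \<open>g\<close> is zero and is a row of the square matrix because \<open>n < m\<close>.\<close>
  have "\<exists>a. (\<exists>i<m. a i \<noteq> 0) \<and> (\<forall>j<m. (\<Sum>i<m. a i * g i j) = 0)"
  proof (intro exI[of _ "\<lambda>i. if i = n then 1 else 0"] conjI)
    show "\<forall>j<m. (\<Sum>i<m. (if i = n then 1 else 0) * g i j) = 0"
      by (auto simp: g_def intro!: sum.neutral)
  qed (use assms in auto)
  then have "det (mat m m (\<lambda>(i, j). g i j)) = 0" by (simp only: det_eq_0_iff_left_kernel)
  then obtain a where a: "\<exists>j<m. a j \<noteq> 0" "\<forall>i<m. (\<Sum>j<m. g i j * a j) = 0"
    unfolding det_eq_0_iff_kernel by blast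
  have "(\<Sum>j<m. f i j * a j) = 0" if "i < n" for i
  proof -
    have "(\<Sum>j<m. g i j * a j) = 0" using a(2) that assms by simp
    then show ?thesis using that by (simp add: g_def)
  qed
  with a(1) show ?thesis by blast
qed

section \<open>Coordinates with respect to a basis\<close>

definition lin_comb :: "('e \<Rightarrow> 'k::field) list \<Rightarrow> (nat \<Rightarrow> 'k) \<Rightarrow> 'e \<Rightarrow> 'k" where
  "lin_comb ws a = (\<lambda>x. \<Sum>i<length ws. a i * (ws ! i) x)"

lemma sum_nth_conv_sum_set:
  assumes "distinct xs"
  shows "(\<Sum>i<length xs. g (xs ! i)) = (\<Sum>x\<in>set xs. g x)"
  by (rule sum.reindex_bij_betw) (simp add: assms bij_betw_nth)

lemma ex_function_on_nth:
  assumes "distinct xs"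
  obtains u where "\<And>i. i < length xs \<Longrightarrow> u (xs ! i) = a i"
proof
  show "a (inv_into {..<length xs} ((!) xs) (xs ! i)) = a i" if "i < length xs" for i
    using that assms by (subst inv_into_f_f) (auto simp: inj_on_nth)
qed

lemma sum_fscale_eq_lin_comb:
  assumes "distinct ws"
  shows "(\<Sum>v\<in>set ws. fscale (u v) v) = lin_comb ws (\<lambda>i. u (ws ! i))"
proof
  fix x
  have "(\<Sum>v\<in>S. fscale (u v) v) x = (\<Sum>v\<in>S. u v * v x)" for S
    by (induction S rule: infinite_finite_induct) (auto simp: fscale_def)
  then show "(\<Sum>v\<in>set ws. fscale (u v) v) x = lin_comb ws (\<lambda>i. u (ws ! i)) x"
    by (simp add: lin_comb_def sum_nth_conv_sum_set[OF assms, of "\<lambda>v. u v * v x", symmetric])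
qed

text \<open>In this form a basis can be fed directly to the statements about kernels of matrices, whose
vectors are indexed by numbers.\<close>

lemma basis_of_iff_coordinates:
  "basis_of W ws \<longleftrightarrow>
     W = range (lin_comb ws) \<and> (\<forall>a. lin_comb ws a = 0 \<longrightarrow> (\<forall>i<length ws. a i = 0))"
proof -
  have lin_comb_cong: "lin_comb ws a = lin_comb ws b" if "\<And>i. i < length ws \<Longrightarrow> a i = b i" for a b
    using that by (auto simp: lin_comb_def)
  have distinct: "distinct ws" if inj: "\<forall>a. lin_comb ws a = 0 \<longrightarrow> (\<forall>i<length ws. a i = 0)"
  proof (unfold distinct_conv_nth, intro allI impI notI)
    fix i j assume ij: "i < length ws" "j < length ws" "i \<noteq> j" "ws ! i = ws ! j"
    \<comment> \<open>A repeated vector cancels against itself.\<close>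
    let ?a = "\<lambda>k. (if k = i then 1 else 0) - (if k = j then 1 else 0)"
    have "lin_comb ws ?a = 0"
    proof
      fix x
      have "?a k * (ws ! k) x = (if k = i then (ws ! k) x else 0) - (if k = j then (ws ! k) x else 0)" for k
        by simp
      then show "lin_comb ws ?a x = 0 x" using ij by (simp add: lin_comb_def sum_subtractf)
    qed
    then show False using inj[rule_format, of ?a i] ij by simp
  qed
  have span: "fun_space.span (set ws) = range (lin_comb ws)" if d: "distinct ws"
  proof -
    have "fun_space.span (set ws) = range (\<lambda>u. lin_comb ws (\<lambda>i. u (ws ! i)))"
      by (simp add: fun_space.span_finite sum_fscale_eq_lin_comb[OF d])
    also have "\<dots> = range (lin_comb ws)"
    proof (intro equalityI subsetI)
      fix v assume "v \<in> range (lin_comb ws)"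
      then obtain a where v: "v = lin_comb ws a" by blast
      obtain u where "\<And>i. i < length ws \<Longrightarrow> u (ws ! i) = a i" using ex_function_on_nth[OF d] by blast
      then have "v = lin_comb ws (\<lambda>i. u (ws ! i))" unfolding v by (intro lin_comb_cong) simp
      then show "v \<in> range (\<lambda>u. lin_comb ws (\<lambda>i. u (ws ! i)))" by blast
    qed auto
    finally show ?thesis .
  qed
  have indep: "fun_space.independent (set ws) \<longleftrightarrow>
      (\<forall>a. lin_comb ws a = 0 \<longrightarrow> (\<forall>i<length ws. a i = 0))" if d: "distinct ws"
  proof -
    have "fun_space.independent (set ws) \<longleftrightarrow>
        (\<forall>u. lin_comb ws (\<lambda>i. u (ws ! i)) = 0 \<longrightarrow> (\<forall>v\<in>set ws. u v = 0))"
      by (auto simp: fun_space.dependent_finite sum_fscale_eq_lin_comb[OF d])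
    also have "\<dots> \<longleftrightarrow> (\<forall>a. lin_comb ws a = 0 \<longrightarrow> (\<forall>i<length ws. a i = 0))"
    proof (intro iffI allI impI)
      fix a i
      assume *: "\<forall>u. lin_comb ws (\<lambda>i. u (ws ! i)) = 0 \<longrightarrow> (\<forall>v\<in>set ws. u v = 0)"
        and a: "lin_comb ws a = 0" and i: "i < length ws"
      obtain u where u: "\<And>i. i < length ws \<Longrightarrow> u (ws ! i) = a i" using ex_function_on_nth[OF d] by blast
      then have "lin_comb ws (\<lambda>i. u (ws ! i)) = 0" unfolding a[symmetric] by (intro lin_comb_cong) simp
      with * i u show "a i = 0" by (metis nth_mem)
    qed (fastforce simp: in_set_conv_nth)
    finally show ?thesis .
  qed
  show ?thesis
  proof (cases "\<forall>a. lin_comb ws a = 0 \<longrightarrow> (\<forall>i<length ws. a i = 0)")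
    case True
    with distinct span indep show ?thesis by (auto simp: basis_of_def)
  next
    case False
    with indep show ?thesis by (auto simp: basis_of_def)
  qed
qed

lemma lin_comb_in:
  assumes "basis_of W ws" shows "lin_comb ws a \<in> W"
  using assms by (auto simp: basis_of_iff_coordinates)

lemma lin_comb_nonzero:
  assumes "basis_of W ws" "i < length ws" "a i \<noteq> 0" shows "lin_comb ws a \<noteq> 0"
  using assms by (auto simp: basis_of_iff_coordinates)

lemma basis_coordinates:
  assumes "basis_of W ws" "w \<in> W"
  obtains a where "w = lin_comb ws a"
  using assms by (auto simp: basis_of_iff_coordinates)

lemma basis_elem_in:
  assumes "basis_of W ws" "i < length ws" shows "ws ! i \<in> W"
  using assms fun_space.span_superset unfolding basis_of_def by (metis nth_mem subsetD)

lemma basis_length_le: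
  assumes ws: "basis_of W ws" and vs: "basis_of W vs"
  shows "length vs \<le> length ws"
proof -
  have "card (set vs) \<le> card (set ws)"
    using ws vs fun_space.span_superset[of "set vs"] unfolding basis_of_def
    by (intro conjunct2[OF fun_space.independent_span_bound]) auto
  then show ?thesis using ws vs by (simp add: basis_of_def distinct_card)
qed

lemma basis_length_unique:
  assumes "basis_of W ws" "basis_of W vs"
  shows "length vs = length ws"
  using assms basis_length_le by (meson le_antisym)

section \<open>Maximal minors\<close>

lemma enumeration:
  assumes "finite B"
  shows "distinct (enumeration B)" "set (enumeration B) = B" "length (enumeration B) = card B"
proof -
  have "distinct (enumeration B) \<and> set (enumeration B) = B"
    unfolding enumeration_def by (rule someI_ex) (use finite_distinct_list[OF assms] in blast)
  then show "distinct (enumeration B)" "set (enumeration B) = B" "length (enumeration B) = card B"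
    using distinct_card[of "enumeration B"] by auto
qed

text \<open>Permuting the columns multiplies the determinant by a sign, so any ordering of the columns may
replace the chosen one once the minor is squared. This allows orderings with a prescribed last
column.\<close>

lemma basis_minor_squared:
  assumes "distinct bs" "length bs = length ws"
  shows "(basis_minor ws (set bs))\<^sup>2 =
    (det (mat (length ws) (length ws) (\<lambda>(i, j). (ws ! i) (bs ! j))))\<^sup>2"
proof -
  let ?n = "length ws" and ?es = "enumeration (set bs)"
  have len: "length ?es = ?n" using assms by (simp add: enumeration distinct_card)
  have "mset bs = mset ?es"
    using assms(1) enumeration[of "set bs"]
    by (intro iffD1[OF set_eq_iff_mset_eq_distinct]) auto
  then obtain p where p: "p permutes {..<length ?es}" "permute_list p ?es = bs"
    by (rule mset_eq_permutation)
  have p': "p permutes {0..<?n}" using p(1) by (simp add: len atLeast0LessThan)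
  have nth: "bs ! j = ?es ! p j" if "j < ?n" for j
    using permute_list_nth[OF p(1), of j] that unfolding p(2) len .
  let ?A = "mat ?n ?n (\<lambda>(i, j). (ws ! i) (?es ! j))"
  \<comment> \<open>Transposing turns the permutation of the columns into one of the rows.\<close>
  have "transpose_mat (mat ?n ?n (\<lambda>(i, j). (ws ! i) (bs ! j)))
      = mat ?n ?n (\<lambda>(i, j). transpose_mat ?A $$ (p i, j))"
    using permutes_in_image[OF p'] by (intro eq_matI) (simp_all add: nth)
  then have "det (mat ?n ?n (\<lambda>(i, j). (ws ! i) (bs ! j)))
      = det (mat ?n ?n (\<lambda>(i, j). transpose_mat ?A $$ (p i, j)))"
    using det_transpose[of "mat ?n ?n (\<lambda>(i, j). (ws ! i) (bs ! j))" ?n] by simp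
  also have "\<dots> = signof p * det ?A"
    by (subst det_permute_rows[OF _ p']) (auto simp: det_transpose[of _ ?n])
  finally have *: "det (mat ?n ?n (\<lambda>(i, j). (ws ! i) (bs ! j))) = signof p * basis_minor ws (set bs)"
    by (simp only: basis_minor_def)
  have "(signof p :: 'b)\<^sup>2 = 1" by (simp add: sign_def)
  then show ?thesis unfolding * by (simp only: power_mult_distrib mult_1)
qed

text \<open>The left kernel of the matrix consists of the coordinates of the vectors of \<open>W\<close> that vanish on
\<open>B\<close>.\<close>

lemma basis_minor_eq_0_iff_vanishing_vector:
  assumes ws: "basis_of W ws" and B: "finite B" "card B = length ws"
  shows "basis_minor ws B = 0 \<longleftrightarrow> (\<exists>w\<in>W. w \<noteq> 0 \<and> (\<forall>x\<in>B. w x = 0))"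
proof -
  let ?n = "length ws" and ?bs = "enumeration B"
  have set_B: "(\<forall>j<?n. P (?bs ! j)) \<longleftrightarrow> (\<forall>x\<in>B. P x)" for P
    using all_set_conv_all_nth[of ?bs P] enumeration[OF B(1)] B(2) by simp
  have "basis_minor ws B = 0 \<longleftrightarrow>
      (\<exists>a. (\<exists>i<?n. a i \<noteq> 0) \<and> (\<forall>x\<in>B. lin_comb ws a x = 0))"
    unfolding basis_minor_def det_eq_0_iff_left_kernel
    by (simp add: lin_comb_def flip: set_B)
  also have "\<dots> \<longleftrightarrow> (\<exists>w\<in>W. w \<noteq> 0 \<and> (\<forall>x\<in>B. w x = 0))"
  proof
    assume "\<exists>a. (\<exists>i<?n. a i \<noteq> 0) \<and> (\<forall>x\<in>B. lin_comb ws a x = 0)"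
    then show "\<exists>w\<in>W. w \<noteq> 0 \<and> (\<forall>x\<in>B. w x = 0)"
      using lin_comb_in[OF ws] lin_comb_nonzero[OF ws] by blast
  next
    assume "\<exists>w\<in>W. w \<noteq> 0 \<and> (\<forall>x\<in>B. w x = 0)"
    then obtain w where w: "w \<in> W" "w \<noteq> 0" "\<forall>x\<in>B. w x = 0" by blast
    then obtain a where a: "w = lin_comb ws a" using basis_coordinates[OF ws] by blast
    have "\<exists>i<?n. a i \<noteq> 0"
    proof (rule ccontr)
      assume "\<not> ?thesis"
      then have "w = 0" unfolding a by (simp add: lin_comb_def fun_eq_iff)
      with w(2) show False ..
    qed
    with a w(3) show "\<exists>a. (\<exists>i<?n. a i \<noteq> 0) \<and> (\<forall>x\<in>B. lin_comb ws a x = 0)" by blast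
  qed
  finally show ?thesis .
qed

text \<open>Vanishing on \<open>B\<close> imposes fewer linear conditions than \<open>W\<close> has dimensions.\<close>

lemma ex_vanishing_vector:
  assumes ws: "basis_of W ws" and B: "finite B" "card B < length ws"
  shows "\<exists>w\<in>W. w \<noteq> 0 \<and> (\<forall>x\<in>B. w x = 0)"
proof -
  let ?bs = "enumeration B"
  obtain a where a: "\<exists>i<length ws. a i \<noteq> 0"
    "\<forall>j<card B. (\<Sum>i<length ws. (ws ! i) (?bs ! j) * a i) = 0"
    using underdetermined_system_has_solution[OF B(2), of "\<lambda>j i. (ws ! i) (?bs ! j)"] by blast
  have "lin_comb ws a x = 0" if x: "x \<in> B" for x
  proof -
    obtain j where "j < card B" "x = ?bs ! j"
      using x enumeration(2,3)[OF B(1)] in_set_conv_nth[of x ?bs] by auto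
    with a(2) show ?thesis by (simp add: lin_comb_def mult.commute)
  qed
  with a(1) show ?thesis using lin_comb_in[OF ws] lin_comb_nonzero[OF ws] by blast
qed

text \<open>The matrices of all minors are multiplied from the left by the same transition matrix, so \<open>d\<close> is
its determinant and does not depend on \<open>B\<close>.\<close>

lemma basis_minor_change_of_basis:
  assumes ws: "basis_of W ws" and vs: "basis_of W vs"
  obtains d where "d \<noteq> 0" "\<And>B. basis_minor vs B = d * basis_minor ws B"
proof -
  let ?n = "length ws"
  have len: "length vs = ?n" using basis_length_unique[OF ws vs] .
  have "\<exists>a. vs ! i = lin_comb ws a" if "i < ?n" for i
    using basis_elem_in[OF vs] basis_coordinates[OF ws] that len by metis
  then obtain C where C: "\<And>i. i < ?n \<Longrightarrow> vs ! i = lin_comb ws (C i)" by metis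
  let ?C = "mat ?n ?n (\<lambda>(i, j). C i j)"
  have minor: "basis_minor vs B = det ?C * basis_minor ws B" for B
  proof -
    let ?M = "\<lambda>us. mat ?n ?n (\<lambda>(i, j). (us ! i) (enumeration B ! j))"
    have "?M vs = ?C * ?M ws"
      by (intro eq_matI) (auto simp: C lin_comb_def scalar_prod_def atLeast0LessThan intro!: sum.cong)
    then show ?thesis
      unfolding basis_minor_def len using det_mult[of ?C ?n "?M ws"] by simp
  qed
  \<comment> \<open>A left kernel vector of the transition matrix would be a relation between the new basis vectors.\<close>
  have "det ?C \<noteq> 0"
  proof
    assume "det ?C = 0"
    then obtain a where a: "\<exists>i<?n. a i \<noteq> 0" "\<forall>j<?n. (\<Sum>i<?n. a i * C i j) = 0"
      unfolding det_eq_0_iff_left_kernel by blast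
    have "lin_comb vs a x = 0" for x
    proof -
      have "lin_comb vs a x = (\<Sum>i<?n. \<Sum>j<?n. a i * C i j * (ws ! j) x)"
        by (simp add: lin_comb_def len C sum_distrib_left mult.assoc)
      also have "\<dots> = (\<Sum>j<?n. (\<Sum>i<?n. a i * C i j) * (ws ! j) x)"
        by (subst sum.swap) (simp add: sum_distrib_right)
      finally show ?thesis using a(2) by simp
    qed
    then have "lin_comb vs a = 0" by (simp add: fun_eq_iff)
    with lin_comb_nonzero[OF vs] a(1) len show False by metis
  qed
  with minor that show thesis by blast
qed

section \<open>Independent sets and bases of the realized matroid\<close>

lemma vanishing_on_basis_iff:
  assumes "basis_of W ws"
  shows "(\<forall>w\<in>W. (\<Sum>x\<in>S. a x * w x) = 0) \<longleftrightarrow> (\<forall>i<length ws. (\<Sum>x\<in>S. a x * (ws ! i) x) = 0)"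
proof (intro iffI ballI)
  fix w assume *: "\<forall>i<length ws. (\<Sum>x\<in>S. a x * (ws ! i) x) = 0" and "w \<in> W"
  then obtain b where "w = lin_comb ws b" using basis_coordinates[OF assms] by blast
  then have "(\<Sum>x\<in>S. a x * w x) = (\<Sum>i<length ws. \<Sum>x\<in>S. a x * (b i * (ws ! i) x))"
    by (simp add: lin_comb_def sum_distrib_left) (rule sum.swap)
  also have "\<dots> = (\<Sum>i<length ws. b i * (\<Sum>x\<in>S. a x * (ws ! i) x))"
    by (simp add: sum_distrib_left mult.left_commute)
  finally show "(\<Sum>x\<in>S. a x * w x) = 0" using * by simp
qed (use assms basis_elem_in in blast)

text \<open>A linear relation between the coordinate functions indexed by \<open>S\<close> has to be tested on a basis of
\<open>W\<close> only, and so amounts to a right kernel vector of the matrix whose columns are indexed by \<open>S\<close>.\<close>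

lemma realized_indep_iff_no_kernel:
  assumes ws: "basis_of W ws" and S: "finite S" "S \<subseteq> E"
  shows "realized_indep E W S \<longleftrightarrow>
    \<not> (\<exists>a. (\<exists>j<card S. a j \<noteq> 0) \<and>
        (\<forall>i<length ws. (\<Sum>j<card S. (ws ! i) (enumeration S ! j) * a j) = 0))"
proof -
  let ?bs = "enumeration S"
  note bs = enumeration[OF S(1)]
  have sum: "(\<Sum>x\<in>S. g x) = (\<Sum>j<card S. g (?bs ! j))" for g :: "'a \<Rightarrow> 'b"
    using sum_nth_conv_sum_set[OF bs(1), of g] bs by simp
  have "realized_indep E W S \<longleftrightarrow>
    (\<forall>a. (\<forall>i<length ws. (\<Sum>x\<in>S. a x * (ws ! i) x) = 0) \<longrightarrow> (\<forall>x\<in>S. a x = 0))"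
    using S(2) by (simp add: realized_indep_def vanishing_on_basis_iff[OF ws])
  also have "\<dots> \<longleftrightarrow> (\<forall>a. (\<forall>i<length ws. (\<Sum>j<card S. (ws ! i) (?bs ! j) * a j) = 0) \<longrightarrow>
      (\<forall>j<card S. a j = 0))"
  proof (intro iffI allI impI ballI)
    fix a j
    assume *: "\<forall>a. (\<forall>i<length ws. (\<Sum>x\<in>S. a x * (ws ! i) x) = 0) \<longrightarrow> (\<forall>x\<in>S. a x = 0)"
      and a: "\<forall>i<length ws. (\<Sum>j<card S. (ws ! i) (?bs ! j) * a j) = 0" and j: "j < card S"
    obtain u where u: "\<And>j. j < card S \<Longrightarrow> u (?bs ! j) = a j"
      using ex_function_on_nth[OF bs(1)] bs(3) by metis
    have "\<forall>i<length ws. (\<Sum>x\<in>S. u x * (ws ! i) x) = 0"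
      using a u by (simp add: sum mult.commute)
    with * have "\<forall>x\<in>S. u x = 0" by blast
    then show "a j = 0" using u[OF j] j bs(2,3) nth_mem[of j ?bs] by auto
  next
    fix a x
    assume *: "\<forall>a. (\<forall>i<length ws. (\<Sum>j<card S. (ws ! i) (?bs ! j) * a j) = 0) \<longrightarrow>
      (\<forall>j<card S. a j = 0)" and a: "\<forall>i<length ws. (\<Sum>x\<in>S. a x * (ws ! i) x) = 0" and x: "x \<in> S"
    have "\<forall>j<card S. a (?bs ! j) = 0"
      using *[rule_format, of "\<lambda>j. a (?bs ! j)"] a by (simp add: sum mult.commute)
    then show "a x = 0" using x bs(2,3) in_set_conv_nth[of x ?bs] by auto
  qed
  finally show ?thesis by blast
qed

lemma realized_indep_iff_basis_minor:
  assumes "basis_of W ws" "finite B" "B \<subseteq> E" "card B = length ws"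
  shows "realized_indep E W B \<longleftrightarrow> basis_minor ws B \<noteq> 0"
  using realized_indep_iff_no_kernel[OF assms(1-3)]
  by (simp add: basis_minor_def det_eq_0_iff_kernel assms(4))

lemma realized_indep_card_le:
  assumes ws: "basis_of W ws" and S: "finite S" and indep: "realized_indep E W S"
  shows "card S \<le> length ws"
proof (rule ccontr)
  assume "\<not> card S \<le> length ws"
  moreover have "S \<subseteq> E" using indep by (simp add: realized_indep_def)
  ultimately show False
    using indep realized_indep_iff_no_kernel[OF ws S, of E]
      underdetermined_system_has_solution[of "length ws" "card S"
        "\<lambda>i j. (ws ! i) (enumeration S ! j)"] by simp
qed

text \<open>Evaluated at \<open>w\<close>, a relation on \<open>insert x B\<close> retains only the term of \<open>x\<close>, so the
coefficient of \<open>x\<close> is zero and a relation on \<open>B\<close> remains.\<close>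

lemma realized_indep_insert:
  assumes B: "realized_indep E W B" "finite B" and x: "x \<in> E"
    and w: "w \<in> W" "\<forall>y\<in>B. w y = 0" "w x \<noteq> 0"
  shows "realized_indep E W (insert x B)"
proof -
  have "x \<notin> B" using w by blast
  have "\<forall>y\<in>insert x B. a y = 0" if a: "\<forall>v\<in>W. (\<Sum>y\<in>insert x B. a y * v y) = 0" for a
  proof -
    have "a x * w x = 0"
      using a[rule_format, OF w(1)] w(2) \<open>x \<notin> B\<close> B(2) by simp
    then have "a x = 0" using w(3) by simp
    then have "\<forall>v\<in>W. (\<Sum>y\<in>B. a y * v y) = 0" using a \<open>x \<notin> B\<close> B(2) by simp
    with B(1) \<open>a x = 0\<close> show ?thesis by (simp add: realized_indep_def)
  qed
  then show ?thesis using B(1) x by (simp add: realized_indep_def)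
qed

text \<open>An independent set \<open>B\<close> smaller than \<open>dim W\<close> is not maximal: some nonzero vector of \<open>W\<close> vanishes on
\<open>B\<close>, and \<open>B\<close> can be enlarged by any element of its support.\<close>

lemma realized_basis_iff:
  assumes E: "finite E" and W: "W \<subseteq> coord_space E" and ws: "basis_of W ws"
  shows "B \<in> matroid_bases (realized_indep E W) \<longleftrightarrow>
    B \<subseteq> E \<and> card B = length ws \<and> basis_minor ws B \<noteq> 0"
proof
  assume "B \<in> matroid_bases (realized_indep E W)"
  then have indep: "realized_indep E W B"
    and max: "\<And>S. realized_indep E W S \<Longrightarrow> B \<subseteq> S \<Longrightarrow> S = B"
    by (auto simp: matroid_bases_def)
  have B: "B \<subseteq> E" "finite B" using indep E by (auto simp: realized_indep_def intro: finite_subset)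
  have "\<not> card B < length ws"
  proof
    assume "card B < length ws"
    then obtain w where w: "w \<in> W" "w \<noteq> 0" "\<forall>y\<in>B. w y = 0"
      using ex_vanishing_vector[OF ws B(2)] by blast
    then obtain x where x: "w x \<noteq> 0" by (auto simp: fun_eq_iff)
    then have "x \<in> E" using w(1) W by (auto simp: coord_space_def)
    then have "insert x B = B"
      using max realized_indep_insert[OF indep B(2) _ w(1,3) x] by blast
    then show False using x w(3) by blast
  qed
  then have "card B = length ws" using realized_indep_card_le[OF ws B(2) indep] by simp
  then show "B \<subseteq> E \<and> card B = length ws \<and> basis_minor ws B \<noteq> 0"
    using B indep realized_indep_iff_basis_minor[OF ws B(2,1)] by simp
next
  assume B: "B \<subseteq> E \<and> card B = length ws \<and> basis_minor ws B \<noteq> 0"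
  then have "finite B" using E finite_subset by blast
  then have "realized_indep E W B" using realized_indep_iff_basis_minor[OF ws] B by blast
  moreover have "S = B" if S: "realized_indep E W S" "B \<subseteq> S" for S
  proof -
    have "finite S" using S(1) E by (auto simp: realized_indep_def intro: finite_subset)
    then show ?thesis using realized_indep_card_le[OF ws _ S(1)] S(2) B card_seteq[of S B] by simp
  qed
  ultimately show "B \<in> matroid_bases (realized_indep E W)" by (simp add: matroid_bases_def)
qed

lemma ex_realized_basis_superset:
  assumes "finite E" "realized_indep E W S"
  shows "\<exists>B\<in>matroid_bases (realized_indep E W). S \<subseteq> B"
proof -
  have "finite {T. realized_indep E W T}"
    by (rule finite_subset[of _ "Pow E"]) (use assms(1) in \<open>auto simp: realized_indep_def\<close>)
  then obtain B where "B \<in> {T. realized_indep E W T}" "S \<subseteq> B"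
    "\<forall>T\<in>{T. realized_indep E W T}. B \<subseteq> T \<longrightarrow> B = T"
    using finite_has_maximal2[of "{T. realized_indep E W T}" S] assms(2) by blast
  then show ?thesis by (auto simp: matroid_bases_def)
qed

lemma realized_indep_not_loop:
  assumes "realized_indep E W S" "e \<in> S"
  shows "\<exists>w\<in>W. w e \<noteq> 0"
proof (rule ccontr)
  assume *: "\<not> ?thesis"
  define a :: "'a \<Rightarrow> 'b" where "a x = (if x = e then 1 else 0)" for x
  have "\<forall>w\<in>W. (\<Sum>x\<in>S. a x * w x) = 0"
    using * by (auto simp: a_def intro!: sum.neutral)
  then have "\<forall>x\<in>S. a x = 0"
    using assms(1) unfolding realized_indep_def by blast
  with assms(2) show False by (auto simp: a_def)
qed

lemma realized_indep_empty: "realized_indep E W {}"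
  by (simp add: realized_indep_def)

lemma loop_iff_coordinate_vanishes:
  assumes E: "finite E" "e \<in> E"
  shows "loop (realized_indep E W) e \<longleftrightarrow> (\<forall>w\<in>W. w e = 0)"
proof
  assume loop: "loop (realized_indep E W) e"
  show "\<forall>w\<in>W. w e = 0"
  proof (intro ballI, rule ccontr)
    fix w assume "w \<in> W" "w e \<noteq> 0"
    then have "realized_indep E W {e}"
      using realized_indep_insert[OF realized_indep_empty _ E(2), of w W] by simp
    then show False
      using ex_realized_basis_superset[OF E(1)] loop unfolding loop_def by blast
  qed
next
  assume *: "\<forall>w\<in>W. w e = 0"
  show "loop (realized_indep E W) e"
    unfolding loop_def
  proof (intro ballI notI)
    fix B assume "B \<in> matroid_bases (realized_indep E W)" and "e \<in> B"
    then have B: "realized_indep E W B" by (simp add: matroid_bases_def)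
    with realized_indep_not_loop[OF B \<open>e \<in> B\<close>] * show False by blast
  qed
qed

text \<open>If \<open>W\<close> contains a vector supported at \<open>e\<close> only, then it vanishes on every set avoiding \<open>e\<close> and
annihilates the minor of such a set. Conversely, let \<open>S\<close> be maximal among the independent sets
avoiding \<open>e\<close>. For a coloop \<open>e\<close> it is not a basis, so a nonzero vector of \<open>W\<close> vanishes on \<open>S\<close>;
by maximality its support cannot meet the rest of \<open>E - {e}\<close>.\<close>

lemma coloop_iff_unit_vector:
  assumes E: "finite E" and W: "W \<subseteq> coord_space E" and ws: "basis_of W ws"
  shows "coloop (realized_indep E W) e \<longleftrightarrow> (\<exists>w\<in>W. w \<noteq> 0 \<and> (\<forall>x. x \<noteq> e \<longrightarrow> w x = 0))"
proof
  assume coloop: "coloop (realized_indep E W) e"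
  let ?\<S> = "{S. realized_indep E W S \<and> e \<notin> S}"
  have fin_\<S>: "finite ?\<S>"
    by (rule finite_subset[of _ "Pow E"]) (use E in \<open>auto simp: realized_indep_def\<close>)
  have "{} \<in> ?\<S>" by (simp add: realized_indep_empty)
  from finite_has_maximal2[OF fin_\<S> this]
  obtain S where S_mem: "S \<in> ?\<S>" and max_\<S>: "\<forall>T\<in>?\<S>. S \<subseteq> T \<longrightarrow> S = T" by blast
  have S: "realized_indep E W S" "e \<notin> S" using S_mem by simp_all
  have max: "S = T" if "realized_indep E W T" "e \<notin> T" "S \<subseteq> T" for T
    using max_\<S> that by simp
  have sub: "S \<subseteq> E" using S(1) by (simp add: realized_indep_def)
  then have fin: "finite S" using E finite_subset by blast
  have "card S \<noteq> length ws"
  proof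
    assume "card S = length ws"
    then have "S \<in> matroid_bases (realized_indep E W)"
      using realized_basis_iff[OF E W ws] realized_indep_iff_basis_minor[OF ws fin sub] S(1) sub
      by blast
    with coloop S(2) show False by (auto simp: coloop_def)
  qed
  then have "card S < length ws" using realized_indep_card_le[OF ws fin S(1)] by simp
  then obtain w where w: "w \<in> W" "w \<noteq> 0" "\<forall>x\<in>S. w x = 0"
    using ex_vanishing_vector[OF ws fin] by blast
  have "w x = 0" if "x \<noteq> e" for x
  proof (rule ccontr)
    assume x: "w x \<noteq> 0"
    then have "x \<in> E" using w(1) W by (auto simp: coord_space_def)
    then have "S = insert x S"
      using max[OF realized_indep_insert[OF S(1) fin _ w(1,3) x]] S(2) that by blast
    with w(3) x show False by blast
  qed
  with w(1,2) show "\<exists>w\<in>W. w \<noteq> 0 \<and> (\<forall>x. x \<noteq> e \<longrightarrow> w x = 0)" by blast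
next
  assume "\<exists>w\<in>W. w \<noteq> 0 \<and> (\<forall>x. x \<noteq> e \<longrightarrow> w x = 0)"
  then obtain w where w: "w \<in> W" "w \<noteq> 0" "\<forall>x. x \<noteq> e \<longrightarrow> w x = 0" by blast
  show "coloop (realized_indep E W) e"
    unfolding coloop_def
  proof (intro ballI, rule ccontr)
    fix B assume "B \<in> matroid_bases (realized_indep E W)" and e: "e \<notin> B"
    then have B: "B \<subseteq> E" "card B = length ws" "basis_minor ws B \<noteq> 0"
      using realized_basis_iff[OF E W ws] by auto
    moreover have "finite B" using B(1) E finite_subset by blast
    moreover have "\<forall>x\<in>B. w x = 0" using w(3) e by auto
    ultimately show False
      using basis_minor_eq_0_iff_vanishing_vector[OF ws, of B] w(1,2) by blast
  qed
qed

section \<open>Polynomials of degree at most one in a variable\<close>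

definition var_free :: "'e \<Rightarrow> ('e, 'k::field) mpoly \<Rightarrow> bool" where
  "var_free e p \<longleftrightarrow> (\<forall>m \<in> Poly_Mapping.keys p. Poly_Mapping.lookup m e = 0)"

lemma var_free_const: "var_free e (const c)"
  by (simp add: var_free_def const_def)

lemma var_free_one: "var_free e 1"
  by (simp add: var_free_def)

lemma var_free_var: "x \<noteq> e \<Longrightarrow> var_free e (var x)"
  by (simp add: var_free_def var_def lookup_single)

lemma var_free_mult: "var_free e p \<Longrightarrow> var_free e q \<Longrightarrow> var_free e (p * q)"
  using keys_mult[of p q] by (fastforce simp: var_free_def lookup_add)

lemma var_free_sum:
  assumes "\<And>i. i \<in> I \<Longrightarrow> var_free e (p i)" shows "var_free e (sum p I)"
  using keys_sum[of p I] assms by (fastforce simp: var_free_def)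

lemma var_free_prod:
  assumes "\<And>i. i \<in> I \<Longrightarrow> var_free e (p i)" shows "var_free e (prod p I)"
  using assms by (induction I rule: infinite_finite_induct) (auto simp: var_free_one intro: var_free_mult)

lemma sum_single_lookup:
  "(\<Sum>m\<in>Poly_Mapping.keys p. Poly_Mapping.single m (Poly_Mapping.lookup p m)) = p"
proof (rule poly_mapping_eqI)
  fix k
  show "Poly_Mapping.lookup (\<Sum>m\<in>Poly_Mapping.keys p. Poly_Mapping.single m (Poly_Mapping.lookup p m)) k
    = Poly_Mapping.lookup p k"
    by (simp add: lookup_sum lookup_single when_def in_keys_iff)
qed

text \<open>Both the partial derivative and the substitution are sums over the monomials of a polynomial
whose terms depend additively on the coefficient. Cancellation may remove monomials from \<open>p + q\<close>;
they contribute zero, so that all three sums can be taken over the monomials of \<open>p\<close> and \<open>q\<close>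
together.\<close>

lemma sum_keys_additive:
  assumes zero: "\<And>m. g m 0 = 0" and add: "\<And>m a b. g m (a + b) = g m a + g m b"
  shows "(\<Sum>m\<in>Poly_Mapping.keys (p + q). g m (Poly_Mapping.lookup (p + q) m)) =
    (\<Sum>m\<in>Poly_Mapping.keys p. g m (Poly_Mapping.lookup p m)) +
    (\<Sum>m\<in>Poly_Mapping.keys q. g m (Poly_Mapping.lookup q m))"
proof -
  let ?S = "Poly_Mapping.keys p \<union> Poly_Mapping.keys q"
  have extend: "(\<Sum>m\<in>Poly_Mapping.keys r. g m (Poly_Mapping.lookup r m)) =
      (\<Sum>m\<in>?S. g m (Poly_Mapping.lookup r m))" if "Poly_Mapping.keys r \<subseteq> ?S" for r
    using that by (intro sum.mono_neutral_left) (auto simp: in_keys_iff zero)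
  show ?thesis
    unfolding extend[OF keys_add] extend[OF Un_upper1] extend[OF Un_upper2]
    by (simp add: lookup_add add sum.distrib)
qed

lemma partial_deriv_add: "partial_deriv e (p + q) = partial_deriv e p + partial_deriv e q"
  unfolding partial_deriv_def
  by (rule sum_keys_additive) (simp_all add: distrib_left single_add)

lemma set_var_zero_add: "set_var_zero e (p + q) = set_var_zero e p + set_var_zero e q"
  unfolding set_var_zero_def substitute_def
  by (rule sum_keys_additive) (simp_all add: const_def distrib_right single_add)

lemma partial_deriv_var_free: "var_free e p \<Longrightarrow> partial_deriv e p = 0"
  by (simp add: partial_deriv_def var_free_def)

lemma partial_deriv_sum: "partial_deriv e (sum p I) = (\<Sum>i\<in>I. partial_deriv e (p i))"
  using partial_deriv_var_free[of e 0]
  by (induction I rule: infinite_finite_induct) (simp_all add: partial_deriv_add var_free_def)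

lemma set_var_zero_sum: "set_var_zero e (sum p I) = (\<Sum>i\<in>I. set_var_zero e (p i))"
proof -
  have "set_var_zero e 0 = 0" by (simp add: set_var_zero_def substitute_def)
  then show ?thesis
    by (induction I rule: infinite_finite_induct) (simp_all add: set_var_zero_add)
qed

lemma partial_deriv_single:
  "partial_deriv e (Poly_Mapping.single m c) =
    Poly_Mapping.single (m - Poly_Mapping.single e 1) (of_nat (Poly_Mapping.lookup m e) * c)"
  by (cases "c = 0") (simp_all add: partial_deriv_def)

lemma var_power: "var x ^ k = Poly_Mapping.single (Poly_Mapping.single x k) 1"
  by (induction k) (simp_all add: var_def mult_single flip: single_add)

lemma prod_single:
  "(\<Prod>x\<in>I. Poly_Mapping.single (f x) 1) = Poly_Mapping.single (\<Sum>x\<in>I. f x) (1 :: 'k::field)"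
  by (induction I rule: infinite_finite_induct) (simp_all add: mult_single)

lemma set_var_zero_single:
  "set_var_zero e (Poly_Mapping.single m c) =
    (if Poly_Mapping.lookup m e = 0 then Poly_Mapping.single m c else 0)"
proof (cases "c = 0")
  case False
  let ?p = "\<lambda>x. ((var(e := 0)) x :: ('a, 'b) mpoly) ^ Poly_Mapping.lookup m x"
  have "set_var_zero e (Poly_Mapping.single m c) = const c * (\<Prod>x\<in>Poly_Mapping.keys m. ?p x)"
    using False by (simp add: set_var_zero_def substitute_def)
  also have "(\<Prod>x\<in>Poly_Mapping.keys m. ?p x) =
      (if Poly_Mapping.lookup m e = 0 then Poly_Mapping.single m 1 else 0)"
  proof (cases "Poly_Mapping.lookup m e = 0")
    case True
    then have "(\<Prod>x\<in>Poly_Mapping.keys m. ?p x) =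
        (\<Prod>x\<in>Poly_Mapping.keys m. Poly_Mapping.single (Poly_Mapping.single x (Poly_Mapping.lookup m x)) 1)"
      by (intro prod.cong) (auto simp: in_keys_iff var_power)
    then show ?thesis using True by (simp add: prod_single sum_single_lookup)
  next
    case False
    then have "\<exists>x\<in>Poly_Mapping.keys m. ?p x = 0"
      by (intro bexI[of _ e]) (auto simp: in_keys_iff zero_power)
    then show ?thesis using False by (simp add: prod_zero)
  qed
  finally show ?thesis by (simp add: const_def mult_single)
qed (simp add: set_var_zero_def substitute_def)

lemma set_var_zero_var_free:
  assumes "var_free e p" shows "set_var_zero e p = p"
proof -
  have "set_var_zero e p = (\<Sum>m\<in>Poly_Mapping.keys p.
      set_var_zero e (Poly_Mapping.single m (Poly_Mapping.lookup p m)))"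
    by (simp only: sum_single_lookup flip: set_var_zero_sum)
  also have "\<dots> = p"
    using assms by (simp add: set_var_zero_single var_free_def sum_single_lookup)
  finally show ?thesis .
qed

lemma var_mult_eq_sum_single:
  "var e * p = (\<Sum>m\<in>Poly_Mapping.keys p.
    Poly_Mapping.single (Poly_Mapping.single e 1 + m) (Poly_Mapping.lookup p m))"
proof -
  have "var e * p = var e * (\<Sum>m\<in>Poly_Mapping.keys p. Poly_Mapping.single m (Poly_Mapping.lookup p m))"
    by (simp only: sum_single_lookup)
  then show ?thesis by (simp add: sum_distrib_left var_def mult_single)
qed

lemma partial_deriv_affine:
  assumes "var_free e p" "var_free e q"
  shows "partial_deriv e (p + var e * q) = q"
proof -
  have "partial_deriv e (var e * q) = (\<Sum>m\<in>Poly_Mapping.keys q. Poly_Mapping.single m (Poly_Mapping.lookup q m))"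
    using assms(2) unfolding var_mult_eq_sum_single partial_deriv_sum partial_deriv_single
    by (intro sum.cong) (simp_all add: var_free_def lookup_add)
  then show ?thesis
    by (simp add: partial_deriv_add partial_deriv_var_free[OF assms(1)] sum_single_lookup)
qed

lemma set_var_zero_affine:
  assumes "var_free e p"
  shows "set_var_zero e (p + var e * q) = p"
proof -
  have "set_var_zero e (var e * q) = 0"
    unfolding var_mult_eq_sum_single set_var_zero_sum set_var_zero_single
    by (simp add: lookup_add)
  then show ?thesis by (simp add: set_var_zero_add set_var_zero_var_free[OF assms])
qed

lemma const_mult: "const a * const b = const (a * b)"
  by (simp add: const_def mult_single)

lemma const_one: "const 1 = 1"
  by (simp add: const_def)

lemma const_zero: "const 0 = 0"
  by (simp add: const_def)

section \<open>The configuration polynomial\<close>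

text \<open>The sets that are not bases contribute zero. The index set depends on \<open>W\<close> only through its
dimension, which makes it possible to compare the polynomials of different spaces term by term.\<close>

lemma config_poly_eq_sum_minors:
  assumes "finite E" "W \<subseteq> coord_space E" "basis_of W ws"
  shows "config_poly E W ws =
    (\<Sum>B | B \<subseteq> E \<and> card B = length ws. const ((basis_minor ws B)\<^sup>2) * (\<Prod>x\<in>B. var x))"
  unfolding config_poly_def
proof (rule sum.mono_neutral_left)
  show "finite {B. B \<subseteq> E \<and> card B = length ws}" using assms(1) by simp
qed (use realized_basis_iff[OF assms] in \<open>auto simp: const_def\<close>)

lemma config_poly_change_of_basis:
  assumes "basis_of W ws" "basis_of W vs"
  obtains d where "d \<noteq> 0" "config_poly E W vs = const (d\<^sup>2) * config_poly E W ws"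
proof -
  obtain d where d: "d \<noteq> 0" "\<And>B. basis_minor vs B = d * basis_minor ws B"
    using basis_minor_change_of_basis[OF assms] by blast
  have "config_poly E W vs = const (d\<^sup>2) * config_poly E W ws"
    unfolding config_poly_def
    by (simp add: d(2) sum_distrib_left power_mult_distrib mult.assoc flip: const_mult)
  with d(1) show thesis by (rule that)
qed

lemma var_free_config_poly:
  "e \<notin> E \<Longrightarrow> var_free e (config_poly E W ws)"
  unfolding config_poly_def
  by (intro var_free_sum var_free_mult var_free_prod var_free_const var_free_var)
    (auto simp: matroid_bases_def realized_indep_def)

lemma config_poly_Nil:
  assumes "finite E" "basis_of W []"
  shows "config_poly E W [] = 1"
proof -
  have "W \<subseteq> coord_space E"
    using assms(2) by (auto simp: basis_of_iff_coordinates lin_comb_def coord_space_def)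
  moreover have "{B. B \<subseteq> E \<and> card B = 0} = {{}}"
    using assms(1) finite_subset by fastforce
  ultimately show ?thesis
    using config_poly_eq_sum_minors[OF assms(1) _ assms(2)]
    by (simp add: basis_minor_def const_one)
qed

section \<open>Deletion, contraction and restriction\<close>

lemma coord_proj_idem: "w \<in> coord_space F \<Longrightarrow> coord_proj F w = w"
  by (auto simp: coord_proj_def coord_space_def)

lemma loop_minors:
  assumes "W \<subseteq> coord_space E" "\<forall>w\<in>W. w e = 0"
  shows "deletion E W {e} = W" "contraction E W {e} = W"
proof -
  have W: "W \<subseteq> coord_space (E - {e})" using assms by (auto simp: coord_space_def)
  then show "contraction E W {e} = W" by (auto simp: contraction_def)
  have "coord_proj (E - {e}) w = w" if "w \<in> W" for w
    using W that by (intro coord_proj_idem) auto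
  then show "deletion E W {e} = W" by (simp add: deletion_def restriction_def)
qed

text \<open>No independent set contains \<open>e\<close>, so \<open>W\<close> realizes the same matroid bases on \<open>E\<close> and on
\<open>E - {e}\<close>.\<close>

lemma config_poly_loop:
  assumes "\<forall>w\<in>W. w e = 0"
  shows "config_poly (E - {e}) W ws = config_poly E W ws"
proof -
  have "realized_indep (E - {e}) W S \<longleftrightarrow> realized_indep E W S" for S
  proof -
    have "e \<notin> S" if S: "realized_indep E W S"
      using realized_indep_not_loop[OF S] assms by blast
    then show ?thesis by (auto simp: realized_indep_def)
  qed
  then have "realized_indep (E - {e}) W = realized_indep E W" by blast
  then show ?thesis by (simp add: config_poly_def)
qed

lemma contraction_eq_hyperplane:
  assumes "W \<subseteq> coord_space E"
  shows "contraction E W {e} = {w \<in> W. w e = 0}"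
  using assms by (auto simp: contraction_def coord_space_def)

text \<open>Up to a scalar \<open>w\<close> is the \<open>e\<close>-th unit vector, so the coordinate \<open>e\<close> of a vector of \<open>W\<close> can be
cleared inside \<open>W\<close>.\<close>

lemma coloop_minors:
  assumes W: "W \<subseteq> coord_space E" "fun_space.subspace W"
    and w: "w \<in> W" "w e \<noteq> 0" "\<forall>x. x \<noteq> e \<longrightarrow> w x = 0"
  shows "deletion E W {e} = contraction E W {e}"
proof -
  have out: "v x = 0" if "v \<in> W" "x \<notin> E" for v x
    using W(1) that by (auto simp: coord_space_def)
  have proj: "coord_proj (E - {e}) v = v - fscale (v e / w e) w" if "v \<in> W" for v
  proof
    fix x
    show "coord_proj (E - {e}) v x = (v - fscale (v e / w e) w) x"
      using out[OF that, of x] w(2,3)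
      by (cases "x = e") (simp_all add: coord_proj_def fscale_def)
  qed
  have mem: "coord_proj (E - {e}) v \<in> contraction E W {e}" if "v \<in> W" for v
  proof -
    have "coord_proj (E - {e}) v \<in> W"
      unfolding proj[OF that]
      by (intro fun_space.subspace_diff fun_space.subspace_scale W(2) w(1) that)
    then show ?thesis by (auto simp: contraction_def coord_proj_def coord_space_def)
  qed
  moreover have "v \<in> deletion E W {e}" if "v \<in> contraction E W {e}" for v
    using that coord_proj_idem[of v "E - {e}"]
    by (auto simp: contraction_def deletion_def restriction_def intro: rev_image_eqI)
  ultimately show ?thesis by (auto simp: deletion_def restriction_def)
qed

text \<open>The contraction is the hyperplane of \<open>W\<close> on which the coordinate \<open>e\<close> vanishes, and \<open>w\<close> lies
outside it.\<close>

lemma basis_extending_contraction: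
  assumes W: "W \<subseteq> coord_space E" "fun_space.subspace W"
    and w: "w \<in> W" "w e \<noteq> 0" and us: "basis_of (contraction E W {e}) us"
  shows "basis_of W (us @ [w])"
proof -
  have con: "contraction E W {e} = {v \<in> W. v e = 0}"
    by (rule contraction_eq_hyperplane[OF W(1)])
  have span: "fun_space.span (set us) = {v \<in> W. v e = 0}" and "distinct us"
    and indep: "fun_space.independent (set us)"
    using us by (auto simp: basis_of_def con)
  have notin: "w \<notin> fun_space.span (set us)" unfolding span using w(2) by simp
  then have "w \<notin> set us" using fun_space.span_base by blast
  have "fun_space.span (insert w (set us)) = W"
  proof -
    have "v \<in> W \<longleftrightarrow> (\<exists>k. v - fscale k w \<in> {v \<in> W. v e = 0})" for v
    proof
      assume "v \<in> W"
      then have "v - fscale (v e / w e) w \<in> W"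
        by (intro fun_space.subspace_diff fun_space.subspace_scale W(2) w(1))
      moreover have "(v - fscale (v e / w e) w) e = 0" using w(2) by (simp add: fscale_def)
      ultimately have "v - fscale (v e / w e) w \<in> {v \<in> W. v e = 0}" by blast
      then show "\<exists>k. v - fscale k w \<in> {v \<in> W. v e = 0}" by blast
    next
      assume "\<exists>k. v - fscale k w \<in> {v \<in> W. v e = 0}"
      then obtain k where "v - fscale k w \<in> W" by blast
      then have "(v - fscale k w) + fscale k w \<in> W"
        by (intro fun_space.subspace_add fun_space.subspace_scale W(2) w(1))
      then show "v \<in> W" by simp
    qed
    then show ?thesis unfolding fun_space.span_insert span by blast
  qed
  then show ?thesis
    using \<open>distinct us\<close> indep notin \<open>w \<notin> set us\<close>
    by (simp add: basis_of_def fun_space.independent_insert)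
qed

text \<open>When the column of \<open>e\<close> is placed last, its only possibly nonzero entry is \<open>w e\<close> in the last row;
Laplace expansion along this column leaves the minor of \<open>us\<close>.\<close>

lemma basis_minor_squared_insert:
  assumes B: "finite B" "e \<notin> B" "card B = length us" and us: "\<forall>u\<in>set us. u e = 0"
  shows "(basis_minor (us @ [w]) (insert e B))\<^sup>2 = (w e)\<^sup>2 * (basis_minor us B)\<^sup>2"
proof -
  let ?n = "length us" and ?bs = "enumeration B"
  note bs = enumeration[OF B(1)]
  define A where "A = mat (Suc ?n) (Suc ?n) (\<lambda>(i, j). ((us @ [w]) ! i) ((?bs @ [e]) ! j))"
  have len: "length ?bs = ?n" using bs(3) B(3) by simp
  have col: "A $$ (i, ?n) = (if i = ?n then w e else 0)" if "i < Suc ?n" for i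
    using that us len by (auto simp: A_def nth_append)
  have "det A = (\<Sum>i<Suc ?n. A $$ (i, ?n) * cofactor A i ?n)"
    by (rule laplace_expansion_column) (auto simp: A_def)
  also have "\<dots> = w e * cofactor A ?n ?n" by (simp add: col)
  also have "cofactor A ?n ?n = basis_minor us B"
  proof -
    have "mat_delete A ?n ?n = mat ?n ?n (\<lambda>(i, j). (us ! i) (?bs ! j))"
      by (rule eq_matI) (auto simp: A_def mat_delete_def nth_append len)
    then show ?thesis by (simp add: cofactor_def basis_minor_def)
  qed
  finally have "det A = w e * basis_minor us B" .
  moreover have "(basis_minor (us @ [w]) (set (?bs @ [e])))\<^sup>2 = (det A)\<^sup>2"
    using bs len B(2) by (subst basis_minor_squared) (auto simp: A_def)
  ultimately show ?thesis using bs(2) by (simp add: power_mult_distrib)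
qed

text \<open>The hypothesis says that forgetting the coordinate \<open>e\<close> is injective on \<open>W\<close>.\<close>

lemma deletion_basis:
  assumes W: "W \<subseteq> coord_space E" and ws: "basis_of W ws"
    and no_unit: "\<not> (\<exists>w\<in>W. w \<noteq> 0 \<and> (\<forall>x. x \<noteq> e \<longrightarrow> w x = 0))"
  shows "basis_of (deletion E W {e}) (map (coord_proj (E - {e})) ws)"
proof -
  let ?P = "coord_proj (E - {e})"
  have comb: "lin_comb (map ?P ws) a = ?P (lin_comb ws a)" for a
    by (auto simp: lin_comb_def coord_proj_def fun_eq_iff)
  have "?P w = 0 \<Longrightarrow> w = 0" if w: "w \<in> W" for w
  proof -
    assume "?P w = 0"
    then have "w x = 0" if "x \<noteq> e" for x
      using W w that by (auto simp: coord_proj_def coord_space_def fun_eq_iff split: if_splits)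
    with no_unit w show "w = 0" by blast
  qed
  then show ?thesis
    using ws unfolding basis_of_iff_coordinates comb deletion_def restriction_def length_map
    by (auto simp: image_image comb)
qed

lemma basis_minor_coord_proj:
  assumes "finite B" "B \<subseteq> F" "card B = length ws"
  shows "basis_minor (map (coord_proj F) ws) B = basis_minor ws B"
proof -
  have "enumeration B ! j \<in> F" if "j < length ws" for j
    using enumeration[OF assms(1)] assms(2,3) that nth_mem[of j "enumeration B"] by auto
  then have "mat (length ws) (length ws) (\<lambda>(i, j). (map (coord_proj F) ws ! i) (enumeration B ! j))
      = mat (length ws) (length ws) (\<lambda>(i, j). (ws ! i) (enumeration B ! j))"
    by (intro eq_matI) (auto simp: coord_proj_def)
  then show ?thesis by (simp add: basis_minor_def)
qed

text \<open>The first summand collects the sets avoiding \<open>e\<close>. The sets containing \<open>e\<close> arise from the sets of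
size \<open>dim W - 1\<close> in \<open>E - {e}\<close> by adding \<open>e\<close>, and their minors are those of the contraction.\<close>

lemma config_poly_split:
  assumes E: "finite E" "e \<in> E" and W: "W \<subseteq> coord_space E" "fun_space.subspace W"
    and w: "w \<in> W" "w e = 1" and us: "basis_of (contraction E W {e}) us"
  shows "config_poly E W (us @ [w]) =
    (\<Sum>B | B \<subseteq> E - {e} \<and> card B = length (us @ [w]).
        const ((basis_minor (us @ [w]) B)\<^sup>2) * (\<Prod>x\<in>B. var x)) +
    var e * config_poly (E - {e}) (contraction E W {e}) us"
proof -
  let ?vs = "us @ [w]" and ?E' = "E - {e}"
  let ?t = "\<lambda>vs B. const ((basis_minor vs B)\<^sup>2) * (\<Prod>x\<in>B. var x)"
  let ?\<A> = "{B. B \<subseteq> ?E' \<and> card B = length ?vs}" and ?\<B> = "{B. B \<subseteq> ?E' \<and> card B = length us}"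
  have us_e: "\<forall>u\<in>set us. u e = 0"
    using us fun_space.span_base unfolding basis_of_def contraction_eq_hyperplane[OF W(1)] by blast
  have fin: "finite B" if "B \<subseteq> E" for B using that E(1) by (rule finite_subset)
  have "{B. B \<subseteq> E \<and> card B = length ?vs} = ?\<A> \<union> insert e ` ?\<B>"
  proof (intro equalityI subsetI)
    fix B assume B: "B \<in> {B. B \<subseteq> E \<and> card B = length ?vs}"
    show "B \<in> ?\<A> \<union> insert e ` ?\<B>"
    proof (cases "e \<in> B")
      case True
      then have "B - {e} \<in> ?\<B>" "B = insert e (B - {e})" using B fin[of B] by auto
      then show ?thesis by blast
    qed (use B in auto)
  next
    fix B assume "B \<in> ?\<A> \<union> insert e ` ?\<B>"
    then show "B \<in> {B. B \<subseteq> E \<and> card B = length ?vs}"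
    proof
      assume "B \<in> insert e ` ?\<B>"
      then obtain B' where B': "B = insert e B'" "B' \<subseteq> ?E'" "card B' = length us" by blast
      then have "finite B'" "e \<notin> B'" using fin[of B'] by auto
      with B' E(2) show ?thesis by auto
    qed auto
  qed
  moreover have "?\<A> \<inter> insert e ` ?\<B> = {}" by auto
  ultimately have "config_poly E W ?vs = (\<Sum>B\<in>?\<A>. ?t ?vs B) + (\<Sum>B\<in>insert e ` ?\<B>. ?t ?vs B)"
    using basis_extending_contraction[OF W w(1) _ us] w(2) E(1)
    by (simp add: config_poly_eq_sum_minors[OF E(1) W(1)] sum.union_disjoint)
  moreover have "(\<Sum>B\<in>insert e ` ?\<B>. ?t ?vs B) = (\<Sum>B\<in>?\<B>. ?t ?vs (insert e B))"
    by (subst sum.reindex) (auto simp: inj_on_def)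
  moreover have "\<dots> = (\<Sum>B\<in>?\<B>. var e * ?t us B)"
  proof (rule sum.cong)
    fix B assume "B \<in> ?\<B>"
    then have B: "finite B" "e \<notin> B" "card B = length us" using fin[of B] by auto
    then show "?t ?vs (insert e B) = var e * ?t us B"
      unfolding basis_minor_squared_insert[OF B us_e] w(2) by (simp add: mult.left_commute)
  qed simp
  moreover have "\<dots> = var e * config_poly ?E' (contraction E W {e}) us"
    using E(1) us by (subst config_poly_eq_sum_minors) (auto simp: contraction_def sum_distrib_left)
  ultimately show ?thesis by simp
qed

text \<open>A vector supported at \<open>e\<close> vanishes on every set avoiding \<open>e\<close>, so the minors of these sets are
zero.\<close>

lemma config_poly_coloop:
  assumes E: "finite E" "e \<in> E" and W: "W \<subseteq> coord_space E" "fun_space.subspace W"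
    and w: "w \<in> W" "w e = 1" and us: "basis_of (contraction E W {e}) us"
    and unit: "\<exists>w\<in>W. w \<noteq> 0 \<and> (\<forall>x. x \<noteq> e \<longrightarrow> w x = 0)"
  shows "config_poly E W (us @ [w]) = var e * config_poly (E - {e}) (contraction E W {e}) us"
proof -
  have vs: "basis_of W (us @ [w])" using basis_extending_contraction[OF W w(1) _ us] w(2) by simp
  have "basis_minor (us @ [w]) B = 0" if B: "B \<subseteq> E - {e}" "card B = length (us @ [w])" for B
  proof -
    have "finite B" using B(1) E(1) finite_subset[of B E] by blast
    moreover have "\<exists>w\<in>W. w \<noteq> 0 \<and> (\<forall>x\<in>B. w x = 0)" using unit B(1) by blast
    ultimately show ?thesis using basis_minor_eq_0_iff_vanishing_vector[OF vs _ B(2)] by blast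
  qed
  then show ?thesis unfolding config_poly_split[OF E W w us] by (simp add: const_zero)
qed

text \<open>The projected basis has the same entries in the columns other than \<open>e\<close>, so the minors avoiding
\<open>e\<close> are the minors of the deletion.\<close>

lemma config_poly_without_unit_vector:
  assumes E: "finite E" "e \<in> E" and W: "W \<subseteq> coord_space E" "fun_space.subspace W"
    and w: "w \<in> W" "w e = 1" and us: "basis_of (contraction E W {e}) us"
    and no_unit: "\<not> (\<exists>w\<in>W. w \<noteq> 0 \<and> (\<forall>x. x \<noteq> e \<longrightarrow> w x = 0))"
  shows "config_poly E W (us @ [w]) =
    config_poly (E - {e}) (deletion E W {e}) (map (coord_proj (E - {e})) (us @ [w])) +
    var e * config_poly (E - {e}) (contraction E W {e}) us"
proof -
  let ?vs = "us @ [w]" and ?E' = "E - {e}"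
  have "basis_of W ?vs" using basis_extending_contraction[OF W w(1) _ us] w(2) by simp
  then have "basis_of (deletion E W {e}) (map (coord_proj ?E') ?vs)"
    using deletion_basis[OF W(1) _ no_unit] by blast
  moreover have "deletion E W {e} \<subseteq> coord_space ?E'"
    by (auto simp: deletion_def restriction_def coord_proj_def coord_space_def)
  ultimately have "config_poly ?E' (deletion E W {e}) (map (coord_proj ?E') ?vs) =
      (\<Sum>B | B \<subseteq> ?E' \<and> card B = length (map (coord_proj ?E') ?vs).
        const ((basis_minor (map (coord_proj ?E') ?vs) B)\<^sup>2) * (\<Prod>x\<in>B. var x))"
    using E(1) by (intro config_poly_eq_sum_minors) auto
  also have "\<dots> = (\<Sum>B | B \<subseteq> ?E' \<and> card B = length ?vs.
        const ((basis_minor ?vs B)\<^sup>2) * (\<Prod>x\<in>B. var x))"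
    unfolding length_map
  proof (rule sum.cong[OF refl])
    fix B assume "B \<in> {B. B \<subseteq> ?E' \<and> card B = length ?vs}"
    then have "B \<subseteq> ?E'" "card B = length ?vs" "finite B"
      using E(1) by (auto intro: finite_subset[of _ E])
    then show "const ((basis_minor (map (coord_proj ?E') ?vs) B)\<^sup>2) * (\<Prod>x\<in>B. var x) =
        const ((basis_minor ?vs B)\<^sup>2) * (\<Prod>x\<in>B. var x)"
      by (simp only: basis_minor_coord_proj)
  qed
  finally show ?thesis unfolding config_poly_split[OF E W w us] by simp
qed

text \<open>The restriction is a line, whose contraction by \<open>e\<close> is zero, so this is the splitting formula on
the one-element ground set.\<close>

lemma config_poly_restriction:
  assumes W: "fun_space.subspace W" and w: "w \<in> W" "w e = 1"
  shows "basis_of (restriction W {e}) [coord_proj {e} w]"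
    and "config_poly {e} (restriction W {e}) [coord_proj {e} w] = var e"
proof -
  let ?R = "restriction W {e}" and ?u = "coord_proj {e} w"
  have R: "?R \<subseteq> coord_space {e}"
    by (auto simp: restriction_def coord_proj_def coord_space_def)
  have subspace: "fun_space.subspace ?R"
  proof (rule fun_space.subspaceI)
    show "0 \<in> ?R"
      using fun_space.subspace_0[OF W] unfolding restriction_def
      by (intro image_eqI[of _ _ 0]) (simp_all add: coord_proj_def fun_eq_iff)
  next
    fix x y assume "x \<in> ?R" "y \<in> ?R"
    then obtain v v' where v: "v \<in> W" "v' \<in> W" "x = coord_proj {e} v" "y = coord_proj {e} v'"
      by (auto simp: restriction_def)
    then have "x + y = coord_proj {e} (v + v')" by (simp add: coord_proj_def fun_eq_iff)
    then show "x + y \<in> ?R" using fun_space.subspace_add[OF W v(1,2)] by (auto simp: restriction_def)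
  next
    fix c x assume "x \<in> ?R"
    then obtain v where v: "v \<in> W" "x = coord_proj {e} v" by (auto simp: restriction_def)
    then have "fscale c x = coord_proj {e} (fscale c v)" by (simp add: coord_proj_def fscale_def fun_eq_iff)
    then show "fscale c x \<in> ?R" using fun_space.subspace_scale[OF W v(1)] by (auto simp: restriction_def)
  qed
  have u: "?u \<in> ?R" "?u e = 1" using w by (auto simp: restriction_def coord_proj_def)
  have "contraction {e} ?R {e} = {0}"
    using fun_space.subspace_0[OF subspace] by (auto simp: contraction_def coord_space_def)
  then have nil: "basis_of (contraction {e} ?R {e}) []"
    by (simp add: basis_of_def fun_space.independent_empty)
  show "basis_of ?R [?u]"
    using basis_extending_contraction[OF R subspace u(1) _ nil] u(2) by simp
  have empty: "{B. B \<subseteq> {e} - {e} \<and> card B = length ([] @ [?u])} = {}" by auto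
  show "config_poly {e} ?R [?u] = var e"
    using config_poly_split[OF _ _ R subspace u nil] config_poly_Nil[OF _ nil, of "{}"]
    unfolding empty by simp
qed

section \<open>The deletion-contraction formula\<close>

theorem proposition3p12:
  fixes E :: "'e set" and indep :: "'e set \<Rightarrow> bool"
    and W :: "('e \<Rightarrow> 'k::field) set" and e :: 'e
    and ws ws_del ws_con ws_res :: "('e \<Rightarrow> 'k) list"
  assumes "matroid E indep"
    and "realization E indep W"
    and "e \<in> E"
    and "basis_of W ws"
    and "basis_of (deletion E W {e}) ws_del"
    and "basis_of (contraction E W {e}) ws_con"
    and "basis_of (restriction W {e}) ws_res"
  shows "\<exists>c c_del c_con c_res :: 'k.
    c \<noteq> 0 \<and> c_del \<noteq> 0 \<and> c_con \<noteq> 0 \<and> c_res \<noteq> 0 \<and>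
    (let \<psi> = const (c\<^sup>2) * config_poly E W ws;
         \<psi>_del = const (c_del\<^sup>2) * config_poly (E - {e}) (deletion E W {e}) ws_del;
         \<psi>_con = const (c_con\<^sup>2) * config_poly (E - {e}) (contraction E W {e}) ws_con;
         \<psi>_res = const (c_res\<^sup>2) * config_poly {e} (restriction W {e}) ws_res
     in
       (ws = [] \<longrightarrow> \<psi> = 1) \<and> (ws_del = [] \<longrightarrow> \<psi>_del = 1) \<and>
       (ws_con = [] \<longrightarrow> \<psi>_con = 1) \<and> (ws_res = [] \<longrightarrow> \<psi>_res = 1) \<and>
       (loop indep e \<longrightarrow> \<psi> = \<psi>_del \<and> \<psi>_del = \<psi>_con) \<and>
       (coloop indep e \<longrightarrow> \<psi> = \<psi>_res * \<psi>_con \<and> \<psi>_res * \<psi>_con = \<psi>_res * \<psi>_del) \<and>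
       (\<not> loop indep e \<and> \<not> coloop indep e \<longrightarrow> \<psi> = \<psi>_del + \<psi>_res * \<psi>_con) \<and>
       (\<not> loop indep e \<longrightarrow> \<psi>_res = var e) \<and>
       (loop indep e \<longrightarrow> partial_deriv e \<psi> = 0) \<and>
       (coloop indep e \<longrightarrow> partial_deriv e \<psi> = \<psi>_con \<and> \<psi>_con = \<psi>_del) \<and>
       (\<not> loop indep e \<and> \<not> coloop indep e \<longrightarrow> partial_deriv e \<psi> = \<psi>_con) \<and>
       (loop indep e \<longrightarrow> set_var_zero e \<psi> = \<psi>_del \<and> \<psi>_del = \<psi>_con) \<and>
       (coloop indep e \<longrightarrow> set_var_zero e \<psi> = 0) \<and>
       (\<not> loop indep e \<and> \<not> coloop indep e \<longrightarrow> set_var_zero e \<psi> = \<psi>_del))"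
proof -
  have E: "finite E" using assms(1) by (rule matroid.finite_ground)
  have W: "W \<subseteq> coord_space E" "fun_space.subspace W"
    and indep: "indep = realized_indep E W"
    using assms(2) by (auto simp: realization_def fun_eq_iff)
  let ?D = "deletion E W {e}" and ?C = "contraction E W {e}" and ?R = "restriction W {e}"
  let ?P = "config_poly E W ws" and ?Pdel = "config_poly (E - {e}) ?D ws_del"
    and ?Pcon = "config_poly (E - {e}) ?C ws_con" and ?Pres = "config_poly {e} ?R ws_res"
  have free: "var_free e ?Pdel" "var_free e ?Pcon" by (simp_all add: var_free_config_poly)
  have con_Nil: "?Pcon = 1" if "ws_con = []"
    using config_poly_Nil[of "E - {e}" ?C] E assms(6) that by simp
  obtain B where B: "B \<in> matroid_bases indep"
    using ex_realized_basis_superset[OF E realized_indep_empty] unfolding indep by blast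
  show ?thesis
  proof (cases "loop indep e")
    case True
    then have not_coloop: "\<not> coloop indep e" using B by (auto simp: loop_def coloop_def)
    have zero: "\<forall>w\<in>W. w e = 0"
      using True loop_iff_coordinate_vanishes[OF E assms(3)] unfolding indep by blast
    note minors = loop_minors[OF W(1) zero]
    have del: "basis_of W ws_del" and con: "basis_of W ws_con"
      using assms(5,6) by (simp_all add: minors)
    \<comment> \<open>The three given bases span the same space, so each polynomial is rescaled to that of \<open>ws\<close>.\<close>
    obtain a where a: "a \<noteq> 0"
      "config_poly (E - {e}) W ws = const (a\<^sup>2) * config_poly (E - {e}) W ws_del"
      by (rule config_poly_change_of_basis[OF del assms(4)])
    obtain b where b: "b \<noteq> 0"
      "config_poly (E - {e}) W ws = const (b\<^sup>2) * config_poly (E - {e}) W ws_con"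
      by (rule config_poly_change_of_basis[OF con assms(4)])
    have P: "?P = const (a\<^sup>2) * ?Pdel" "?P = const (b\<^sup>2) * ?Pcon"
      using a(2) b(2) by (simp_all only: minors config_poly_loop[OF zero])
    have P_free: "var_free e ?P"
      using var_free_config_poly[of e "E - {e}" W ws] by (simp add: config_poly_loop[OF zero])
    have P_Nil: "?P = 1" if "ws = [] \<or> ws_del = [] \<or> ws_con = []"
    proof -
      have "ws = []"
        using that basis_length_unique[OF del assms(4)] basis_length_unique[OF con assms(4)] by auto
      then show ?thesis using config_poly_Nil[OF E] assms(4) by simp
    qed
    have empty_bases: "ws = [] \<Longrightarrow> ?P = 1" "ws_del = [] \<Longrightarrow> const (a\<^sup>2) * ?Pdel = 1"
      "ws_con = [] \<Longrightarrow> const (b\<^sup>2) * ?Pcon = 1"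
      using P_Nil unfolding P[symmetric] by blast+
    have res_Nil: "?Pres = 1" if "ws_res = []"
      using config_poly_Nil[of "{e}" ?R] assms(7) that by simp
    show ?thesis
      unfolding Let_def
      by (rule exI[of _ "1 :: 'k"], rule exI[of _ a], rule exI[of _ b], rule exI[of _ "1 :: 'k"])
        (use True not_coloop a(1) b(1) empty_bases res_Nil P_free in
          \<open>simp add: const_one partial_deriv_var_free set_var_zero_var_free flip: P\<close>)
  next
    case False
    then obtain v where v: "v \<in> W" "v e \<noteq> 0"
      using loop_iff_coordinate_vanishes[OF E assms(3)] unfolding indep by blast
    \<comment> \<open>Normalizing the coordinate \<open>e\<close> to \<open>1\<close> lets the polynomial of the contraction keep the factor
      \<open>1\<close>; in particular it is \<open>1\<close> if \<open>ws_con\<close> is empty.\<close>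
    define w where "w = fscale (1 / v e) v"
    have "w \<in> W" unfolding w_def by (rule fun_space.subspace_scale[OF W(2) v(1)])
    moreover have "w e = 1" using v(2) by (simp add: w_def fscale_def)
    ultimately have w: "w \<in> W" "w e = 1" .
    have basis: "basis_of W (ws_con @ [w])"
      using basis_extending_contraction[OF W w(1) _ assms(6)] w(2) by simp
    obtain a where a: "a \<noteq> 0"
      "config_poly E W (ws_con @ [w]) = const (a\<^sup>2) * config_poly E W ws"
      by (rule config_poly_change_of_basis[OF assms(4) basis])
    note res = config_poly_restriction[OF W(2) w]
    obtain b where b: "b \<noteq> 0"
      "config_poly {e} ?R [coord_proj {e} w] = const (b\<^sup>2) * config_poly {e} ?R ws_res"
      by (rule config_poly_change_of_basis[OF assms(7) res(1)])
    have Pres: "const (b\<^sup>2) * ?Pres = var e" using b(2) res(2) by simp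
    have nonempty: "ws \<noteq> []" "ws_res \<noteq> []"
      using basis_length_unique[OF assms(4) basis] basis_length_unique[OF assms(7) res(1)] by auto
    have coloop: "coloop indep e \<longleftrightarrow> (\<exists>w\<in>W. w \<noteq> 0 \<and> (\<forall>x. x \<noteq> e \<longrightarrow> w x = 0))"
      unfolding indep by (rule coloop_iff_unit_vector[OF E W(1) assms(4)])
    show ?thesis
    proof (cases "coloop indep e")
      case True
      then obtain u where u: "u \<in> W" "u \<noteq> 0" "\<forall>x. x \<noteq> e \<longrightarrow> u x = 0" using coloop by blast
      have "u e \<noteq> 0"
      proof
        assume "u e = 0"
        then have "u x = 0" for x using u(3) by (cases "x = e") auto
        with u(2) show False by (simp add: fun_eq_iff)
      qed
      note minors_eq = coloop_minors[OF W u(1) this u(3)]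
      have del: "basis_of ?C ws_del"
        using assms(5) minors_eq by simp
      obtain f where f: "f \<noteq> 0"
        "config_poly (E - {e}) ?C ws_con = const (f\<^sup>2) * config_poly (E - {e}) ?C ws_del"
        by (rule config_poly_change_of_basis[OF del assms(6)])
      have Pcon: "?Pcon = const (f\<^sup>2) * ?Pdel" unfolding minors_eq by (rule f(2))
      have del_Nil: "const (f\<^sup>2) * ?Pdel = 1" if "ws_del = []"
        using basis_length_unique[OF del assms(6)] that con_Nil unfolding Pcon by simp
      have P: "const (a\<^sup>2) * ?P = var e * ?Pcon"
        using config_poly_coloop[OF E assms(3) W w assms(6)] coloop True a(2) by simp
      have calculus: "partial_deriv e (var e * ?Pcon) = ?Pcon" "set_var_zero e (var e * ?Pcon) = 0"
        using partial_deriv_affine[of e 0 ?Pcon] set_var_zero_affine[of e 0 ?Pcon] free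
        by (simp_all add: var_free_def)
      show ?thesis
        unfolding Let_def
        by (rule exI[of _ a], rule exI[of _ f], rule exI[of _ "1 :: 'k"], rule exI[of _ b])
          (use False True a(1) b(1) f(1) P Pres calculus nonempty con_Nil del_Nil in
            \<open>simp add: const_one flip: Pcon\<close>)
    next
      case not_coloop: False
      note P_basis = config_poly_without_unit_vector[OF E assms(3) W w assms(6) not_coloop[unfolded coloop]]
      have basis_del: "basis_of ?D (map (coord_proj (E - {e})) (ws_con @ [w]))"
        using deletion_basis[OF W(1) basis] not_coloop coloop by blast
      obtain f where f: "f \<noteq> 0"
        "config_poly (E - {e}) ?D (map (coord_proj (E - {e})) (ws_con @ [w])) =
          const (f\<^sup>2) * config_poly (E - {e}) ?D ws_del"
        by (rule config_poly_change_of_basis[OF assms(5) basis_del])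
      have P: "const (a\<^sup>2) * ?P = const (f\<^sup>2) * ?Pdel + var e * ?Pcon"
        using P_basis unfolding a(2) f(2) .
      have del_nonempty: "ws_del \<noteq> []"
        using basis_length_unique[OF assms(5) basis_del] by auto
      have del_free: "var_free e (const (f\<^sup>2) * ?Pdel)"
        by (intro var_free_mult var_free_const free)
      show ?thesis
        unfolding Let_def
        by (rule exI[of _ a], rule exI[of _ f], rule exI[of _ "1 :: 'k"], rule exI[of _ b])
          (use False not_coloop a(1) b(1) f(1) P Pres nonempty con_Nil del_nonempty in
            \<open>simp add: const_one partial_deriv_affine[OF del_free free(2)]
              set_var_zero_affine[OF del_free]\<close>)
    qed
  qed
qed

end
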